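(* Let $N=2^n$ and let $G\subseteq[N]\times[N]$ be a uniformly random subset (bipartite graph). Then asymptotically almost surely (as $n\to\infty$), $\rho(G,\mathcal G_{N,N})=\Theta(N)$; that is, there are absolute constants $0<c_1\le c_2$ such that $\Pr[c_1N\le\rho(G,\mathcal G_{N,N})\le c_2N]\to1$ as $n\to\infty$.
   Context: Ground set $\Gamma=[N]\times[N]$ with generators $\mathcal G_{N,N}=\{R_1,\dots,R_N,C_1,\dots,C_N\}$, where $R_i=\{(i,j):j\in[N]\}$ and $C_j=\{(i,j):i\in[N]\}$. Cover complexity: for $A\subseteq\Gamma$ and a family $\mathcal B$ of subsets of $\Gamma$, let $U=\Gamma\setminus A$. A semi-filter over $U$ is a nonempty family $\mathcal F\subseteq\mathcal P(U)$ with $\emptyset\notin\mathcal F$ such that $U_1\in\mathcal F$ and $U_1\subseteq U_2\subseteq U$ imply $U_2\in\mathcal F$. $\mathcal F$ is above $w\in\Gamma$ if for every $B\in\mathcal B$ with $w\in B$ we have $B\cap U\in\mathcal F$. $\mathcal F$ preserves a pair $(E,H)$ of subsets of $U$ if $E,H\in\mathcal F$ imply $E\cap H\in\mathcal F$; it preserves a collection $\Lambda$ of pairs if it preserves each pair. $\rho(A,\mathcal B)$ is the minimum size of a collection $\Lambda$ of pairs of subsets of $U$ such that no semi-filter over $U$ preserving $\Lambda$ is above some element of $A$ ($\infty$ if none exists). *)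

theory Defs
  imports "HOL-Probability.Probability"
begin

definition grid :: "nat \<Rightarrow> (nat \<times> nat) set" where
  "grid N = {1..N} \<times> {1..N}"

definition row :: "nat \<Rightarrow> nat \<Rightarrow> (nat \<times> nat) set" where
  "row N i = {(i, j) |j. j \<in> {1..N}}"

definition column :: "nat \<Rightarrow> nat \<Rightarrow> (nat \<times> nat) set" where
  "column N j = {(i, j) |i. i \<in> {1..N}}"

definition grid_generators :: "nat \<Rightarrow> (nat \<times> nat) set set" where
  "grid_generators N = row N ` {1..N} \<union> column N ` {1..N}"

definition semi_filter :: "'a set \<Rightarrow> 'a set set \<Rightarrow> bool" where
  "semi_filter U F \<longleftrightarrow>
     F \<subseteq> Pow U \<and> F \<noteq> {} \<and> {} \<notin> F \<and>
     (\<forall>U1 U2. U1 \<in> F \<and> U1 \<subseteq> U2 \<and> U2 \<subseteq> U \<longrightarrow> U2 \<in> F)"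

definition above :: "'a set \<Rightarrow> 'a set set \<Rightarrow> 'a set set \<Rightarrow> 'a \<Rightarrow> bool" where
  "above U \<B> F w \<longleftrightarrow> (\<forall>B\<in>\<B>. w \<in> B \<longrightarrow> B \<inter> U \<in> F)"

definition preserves :: "'a set set \<Rightarrow> ('a set \<times> 'a set) set \<Rightarrow> bool" where
  "preserves F \<Lambda> \<longleftrightarrow> (\<forall>(E, H)\<in>\<Lambda>. E \<in> F \<and> H \<in> F \<longrightarrow> E \<inter> H \<in> F)"

definition covering_pairs ::
  "'a set \<Rightarrow> 'a set \<Rightarrow> 'a set set \<Rightarrow> ('a set \<times> 'a set) set \<Rightarrow> bool" where
  "covering_pairs \<Gamma> A \<B> \<Lambda> \<longleftrightarrow>
     (let U = \<Gamma> - A in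
        \<Lambda> \<subseteq> Pow U \<times> Pow U \<and>
        \<not> (\<exists>F. semi_filter U F \<and> preserves F \<Lambda> \<and> (\<exists>w\<in>A. above U \<B> F w)))"

text \<open>The infimum of a nonempty set in \<^typ>\<open>enat\<close> is its minimum, and the infimum of the
  empty set is \<open>\<infinity>\<close>. Requiring \<open>finite \<Lambda>\<close> prevents an infinite collection from being
  counted with \<open>card \<Lambda> = 0\<close>.\<close>

definition cover_complexity :: "'a set \<Rightarrow> 'a set \<Rightarrow> 'a set set \<Rightarrow> enat" where
  "cover_complexity \<Gamma> A \<B> =
     Inf {enat (card \<Lambda>) |\<Lambda>. finite \<Lambda> \<and> covering_pairs \<Gamma> A \<B> \<Lambda>}"

definition random_graph :: "nat \<Rightarrow> (nat \<times> nat) set pmf" where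
  "random_graph N = pmf_of_set (Pow (grid N))"

end

theory Submission
  imports Defs "HOL-Real_Asymp.Real_Asymp"
begin

text \<open>
  Upper bound, for every graph: the \<open>N\<close> pairs consisting of the trace of row \<open>i\<close> on the
  complement of \<open>G\<close> and of the union of the traces of the columns \<open>j\<close> with
  \<open>(i, j) \<in> G\<close> have empty intersections and rule out every element of \<open>G\<close>.

  Lower bound, by counting: the least family above \<open>w\<close> that preserves \<open>\<Lambda>\<close> is generated by
  the traces of the generators containing \<open>w\<close> and by those intersections \<open>E \<inter> H\<close> of pairs in
  \<open>\<Lambda>\<close> which successively become available. Whether it contains the empty set can be read
  off from the table recording which of these generating sets are contained in which of the sets
  \<open>E\<close>, \<open>H\<close> and \<open>{}\<close>. A collection covering \<open>A\<close> derives the empty set exactly from the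
  elements of \<open>A\<close>, so the table determines \<open>A\<close>. For \<open>s\<close> pairs and \<open>2 N\<close> generators there
  are at most \<open>2 ^ ((2 N + s) (2 s + 1))\<close> tables, a vanishing fraction of \<open>2 ^ N\<^sup>2\<close> when
  \<open>s \<le> N / 10\<close>.
\<close>

section \<open>Encoding covered sets by finite tables\<close>

datatype 'a source = Gen "'a set" | Meet nat

definition sources :: "'a set set \<Rightarrow> nat \<Rightarrow> 'a source set" where
  "sources \<B> s = Gen ` \<B> \<union> Meet ` {..<s}"

text \<open>Sources are bare names, and \<open>L\<close> and \<open>R\<close> record which of them
  lie inside the first or second component of pair \<open>k\<close>. Derivability therefore refers
  neither to the covered set nor to the pairs themselves.\<close>

inductive derivable ::
  "'a set set \<Rightarrow> nat \<Rightarrow> ('a source \<times> nat) set \<Rightarrow> ('a source \<times> nat) set \<Rightarrow> 'a \<Rightarrow> 'a source \<Rightarrow> bool"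
  for \<B> s L R w where
  Gen: "B \<in> \<B> \<Longrightarrow> w \<in> B \<Longrightarrow> derivable \<B> s L R w (Gen B)"
| Meet: "derivable \<B> s L R w a \<Longrightarrow> derivable \<B> s L R w b \<Longrightarrow> (a, k) \<in> L \<Longrightarrow> (b, k) \<in> R \<Longrightarrow>
    k < s \<Longrightarrow> derivable \<B> s L R w (Meet k)"

definition decode ::
  "'a set \<Rightarrow> 'a set set \<Rightarrow> nat \<Rightarrow>
   ('a source \<times> nat) set \<times> ('a source \<times> nat) set \<times> 'a source set \<Rightarrow> 'a set" where
  "decode \<Gamma> \<B> s = (\<lambda>(L, R, Z). {w \<in> \<Gamma>. \<exists>a\<in>Z. derivable \<B> s L R w a})"

fun source_set :: "'a set \<Rightarrow> (nat \<Rightarrow> 'a set \<times> 'a set) \<Rightarrow> 'a source \<Rightarrow> 'a set" where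
  "source_set U e (Gen B) = B \<inter> U"
| "source_set U e (Meet k) = fst (e k) \<inter> snd (e k)"

lemma derivable_in_sources: "derivable \<B> s L R w a \<Longrightarrow> a \<in> sources \<B> s"
  by (induction rule: derivable.induct) (auto simp: sources_def)

lemma card_sources_le:
  assumes "finite \<B>"
  shows "card (sources \<B> s) \<le> card \<B> + s"
proof -
  have "card (sources \<B> s) \<le> card (Gen ` \<B>) + card ((Meet :: nat \<Rightarrow> 'a source) ` {..<s})"
    unfolding sources_def by (rule card_Un_le)
  also have "\<dots> \<le> card \<B> + card {..<s}"
    by (intro add_mono card_image_le) (use assms in auto)
  finally show ?thesis by simp
qed

text \<open>Padding, with repetitions allowed, gives all collections of at most \<open>s\<close>
  pairs tables of one common format.\<close>

lemma enumerate_padded: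
  assumes "finite \<Lambda>" "card \<Lambda> \<le> s"
  obtains e where "\<Lambda> \<subseteq> e ` {..<s}" "e ` {..<s} \<subseteq> insert z \<Lambda>"
proof -
  obtain f where f: "bij_betw f {0..<card \<Lambda>} \<Lambda>"
    using ex_bij_betw_nat_finite[OF assms(1)] by blast
  define e where "e k = (if k < card \<Lambda> then f k else z)" for k
  have "\<Lambda> \<subseteq> e ` {..<s}"
  proof
    fix x assume "x \<in> \<Lambda>"
    then obtain k where "k < card \<Lambda>" "x = f k"
      using f unfolding bij_betw_def by (metis atLeastLessThan_iff imageE)
    with assms(2) show "x \<in> e ` {..<s}"
      by (intro image_eqI[of _ _ k]) (auto simp: e_def)
  qed
  moreover have "e ` {..<s} \<subseteq> insert z \<Lambda>"
    using f by (auto simp: e_def bij_betw_def)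
  ultimately show ?thesis by (rule that)
qed

text \<open>A point of \<open>A\<close> that derived no empty set would have a semi-filter above it
  preserving \<open>\<Lambda>\<close>; a point outside \<open>A\<close> lies in every set it
  derives, so it derives no empty one.\<close>

lemma covered_set_decodable:
  assumes sub: "A \<subseteq> \<Gamma>" and gens: "\<Gamma> \<subseteq> \<Union>\<B>"
    and fin: "finite \<Lambda>" and card: "card \<Lambda> \<le> s"
    and cov: "covering_pairs \<Gamma> A \<B> \<Lambda>"
  shows "A \<in> decode \<Gamma> \<B> s `
    (Pow (sources \<B> s \<times> {..<s}) \<times> Pow (sources \<B> s \<times> {..<s}) \<times> Pow (sources \<B> s))"
proof -
  define U where "U = \<Gamma> - A"
  have \<Lambda>U: "\<Lambda> \<subseteq> Pow U \<times> Pow U"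
    and no_filter: "\<And>F w. semi_filter U F \<Longrightarrow> preserves F \<Lambda> \<Longrightarrow> w \<in> A \<Longrightarrow> \<not> above U \<B> F w"
    using cov unfolding covering_pairs_def U_def Let_def by blast+
  \<comment> \<open>The padding pair is harmless: its components lie in \<open>U\<close>, and its
    meet becomes derivable only from sources that are already empty.\<close>
  obtain e where e1: "\<Lambda> \<subseteq> e ` {..<s}" and e2: "e ` {..<s} \<subseteq> insert ({}, {}) \<Lambda>"
    using enumerate_padded[OF fin card] by blast
  define X where "X = source_set U e"
  define L where "L = {(a, k) \<in> sources \<B> s \<times> {..<s}. X a \<subseteq> fst (e k)}"
  define R where "R = {(a, k) \<in> sources \<B> s \<times> {..<s}. X a \<subseteq> snd (e k)}"
  define Z where "Z = {a \<in> sources \<B> s. X a = {}}"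
  have eU: "fst (e k) \<subseteq> U" "snd (e k) \<subseteq> U" if "k < s" for k
  proof -
    have "e k \<in> insert ({}, {}) \<Lambda>" using e2 that by blast
    with \<Lambda>U show "fst (e k) \<subseteq> U" "snd (e k) \<subseteq> U"
      by (cases "e k"; auto)+
  qed
  have XU: "X a \<subseteq> U" if "derivable \<B> s L R w a" for w a
    using derivable_in_sources[OF that] by (auto simp: sources_def X_def intro: subsetD[OF eU(1)])
  have sound: "w \<in> X a" if "derivable \<B> s L R w a" "w \<in> U" for w a
    using that by (induction rule: derivable.induct) (auto simp: X_def L_def R_def)
  have complete: "\<exists>a\<in>Z. derivable \<B> s L R w a" if w: "w \<in> A" for w
  proof (rule ccontr)
    assume no: "\<not> ?thesis"
    \<comment> \<open>The upward closure in \<open>U\<close> of the sets derived from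
      \<open>w\<close>.\<close>
    define F where "F = {Y. Y \<subseteq> U \<and> (\<exists>a. derivable \<B> s L R w a \<and> X a \<subseteq> Y)}"
    have derI: "X a \<in> F" if "derivable \<B> s L R w a" for a
      using that XU[OF that] unfolding F_def by blast
    obtain B where "B \<in> \<B>" "w \<in> B" using w sub gens by (meson UnionE subsetD)
    from derI[OF derivable.Gen[OF this]] have "F \<noteq> {}" by blast
    moreover have "{} \<notin> F"
    proof
      assume "{} \<in> F"
      then obtain a where a: "derivable \<B> s L R w a" "X a = {}"
        unfolding F_def by auto
      then have "a \<in> Z"
        using derivable_in_sources[OF a(1)] by (simp add: Z_def)
      with no a(1) show False by blast
    qed
    moreover have "F \<subseteq> Pow U" by (auto simp: F_def)
    moreover have "U2 \<in> F" if "U1 \<in> F" "U1 \<subseteq> U2" "U2 \<subseteq> U" for U1 U2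
      using that order_trans[of _ U1 U2] unfolding F_def by blast
    ultimately have "semi_filter U F"
      unfolding semi_filter_def by metis
    moreover have "preserves F \<Lambda>"
      unfolding preserves_def
    proof (intro ballI, clarify)
      fix E H assume EH: "(E, H) \<in> \<Lambda>" "E \<in> F" "H \<in> F"
      obtain k where k: "k < s" "e k = (E, H)" using e1 EH(1) by (metis imageE lessThan_iff subsetD)
      obtain a b where a: "derivable \<B> s L R w a" "X a \<subseteq> E"
        and b: "derivable \<B> s L R w b" "X b \<subseteq> H"
        using EH(2,3) unfolding F_def by blast
      have "(a, k) \<in> L"
        using k a(2) derivable_in_sources[OF a(1)] by (simp add: L_def)
      moreover have "(b, k) \<in> R"
        using k b(2) derivable_in_sources[OF b(1)] by (simp add: R_def)
      ultimately have "derivable \<B> s L R w (Meet k)"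
        using a(1) b(1) k(1) by (intro derivable.Meet)
      from derI[OF this] show "E \<inter> H \<in> F" using k(2) by (simp add: X_def)
    qed
    moreover have "above U \<B> F w"
      unfolding above_def
    proof (intro ballI impI)
      fix B assume "B \<in> \<B>" "w \<in> B"
      from derI[OF derivable.Gen[OF this]] show "B \<inter> U \<in> F" by (simp add: X_def)
    qed
    ultimately show False using no_filter w by blast
  qed
  have "A = decode \<Gamma> \<B> s (L, R, Z)"
  proof -
    have "w \<in> A \<longleftrightarrow> (\<exists>a\<in>Z. derivable \<B> s L R w a)" if "w \<in> \<Gamma>" for w
      using that complete[of w] sound[of w] unfolding U_def Z_def by blast
    then show ?thesis
      using sub unfolding decode_def by auto
  qed
  moreover have "L \<subseteq> sources \<B> s \<times> {..<s}" "R \<subseteq> sources \<B> s \<times> {..<s}" "Z \<subseteq> sources \<B> s"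
    by (auto simp: L_def R_def Z_def)
  ultimately show ?thesis by blast
qed

text \<open>A table spends \<open>2 * s + 1\<close> bits per source: \<open>s\<close> each for
  \<open>L\<close> and \<open>R\<close>, and one for \<open>Z\<close>.\<close>

theorem card_cover_complexity_le:
  fixes \<Gamma> :: "'a set"
  assumes "finite \<B>" "\<Gamma> \<subseteq> \<Union>\<B>"
  shows "card {A. A \<subseteq> \<Gamma> \<and> cover_complexity \<Gamma> A \<B> \<le> enat s} \<le> 2 ^ ((card \<B> + s) * (2 * s + 1))"
proof -
  let ?S = "sources \<B> s"
  let ?T = "Pow (?S \<times> {..<s}) \<times> Pow (?S \<times> {..<s}) \<times> Pow ?S"
  have fS: "finite ?S" using assms(1) by (simp add: sources_def)
  have "{A. A \<subseteq> \<Gamma> \<and> cover_complexity \<Gamma> A \<B> \<le> enat s} \<subseteq> decode \<Gamma> \<B> s ` ?T"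
  proof clarify
    fix A assume A: "A \<subseteq> \<Gamma>" "cover_complexity \<Gamma> A \<B> \<le> enat s"
    \<comment> \<open>The strict form lets \<open>Inf_less_iff\<close> produce an actual
      collection.\<close>
    then have "cover_complexity \<Gamma> A \<B> < enat (Suc s)"
      by (simp add: order_le_less_trans)
    then obtain \<Lambda> where "finite \<Lambda>" "covering_pairs \<Gamma> A \<B> \<Lambda>" "card \<Lambda> \<le> s"
      unfolding cover_complexity_def Inf_less_iff by auto
    then show "A \<in> decode \<Gamma> \<B> s ` ?T"
      using covered_set_decodable A(1) assms(2) by blast
  qed
  then have "card {A. A \<subseteq> \<Gamma> \<and> cover_complexity \<Gamma> A \<B> \<le> enat s} \<le> card (decode \<Gamma> \<B> s ` ?T)"
    by (intro card_mono) (use fS in auto)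
  also have "\<dots> \<le> card ?T" by (intro card_image_le) (use fS in auto)
  also have "\<dots> = 2 ^ (card ?S * (2 * s + 1))"
    using fS by (simp add: card_cartesian_product card_Pow power_add[symmetric] algebra_simps)
  also have "\<dots> \<le> 2 ^ ((card \<B> + s) * (2 * s + 1))"
    using card_sources_le[OF assms(1)] by (intro power_increasing mult_right_mono) auto
  finally show ?thesis .
qed

section \<open>Grid generators and the linear upper bound\<close>

lemma finite_grid_generators: "finite (grid_generators N)"
  by (simp add: grid_generators_def)

lemma card_grid_generators_le: "card (grid_generators N) \<le> 2 * N"
proof -
  have "card (grid_generators N) \<le> card (row N ` {1..N}) + card (column N ` {1..N})"
    unfolding grid_generators_def by (rule card_Un_le)
  also have "\<dots> \<le> card {1..N} + card {1..N}"
    by (intro add_mono card_image_le) auto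
  finally show ?thesis by simp
qed

lemma grid_covered_by_generators: "grid N \<subseteq> \<Union>(grid_generators N)"
  by (auto simp: grid_def grid_generators_def row_def)

lemma cover_complexity_grid_le:
  assumes G: "G \<subseteq> grid N"
  shows "cover_complexity (grid N) G (grid_generators N) \<le> enat N"
proof -
  define U where "U = grid N - G"
  define C where "C i = (\<Union>j\<in>{j \<in> {1..N}. (i, j) \<in> G}. column N j \<inter> U)" for i
  define \<Lambda> where "\<Lambda> = (\<lambda>i. (row N i \<inter> U, C i)) ` {1..N}"
  \<comment> \<open>A common point would be some (i, j) in \<open>G\<close>, but \<open>U\<close>
    avoids \<open>G\<close>.\<close>
  have disjoint: "row N i \<inter> U \<inter> C i = {}" for i
    by (auto simp: C_def U_def row_def column_def)
  have "\<not> above U (grid_generators N) F w"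
    if F: "semi_filter U F" "preserves F \<Lambda>" and w: "w \<in> G" for F w
  proof
    assume above: "above U (grid_generators N) F w"
    obtain i j where ij: "w = (i, j)" "i \<in> {1..N}" "j \<in> {1..N}"
      using w G by (auto simp: grid_def)
    have "row N i \<in> grid_generators N" "column N j \<in> grid_generators N" "w \<in> row N i" "w \<in> column N j"
      using ij by (auto simp: grid_generators_def row_def column_def)
    with above have row: "row N i \<inter> U \<in> F" and column: "column N j \<inter> U \<in> F"
      unfolding above_def by blast+
    have "column N j \<inter> U \<subseteq> C i" "C i \<subseteq> U"
      using ij w unfolding C_def by blast+
    with column F(1) have "C i \<in> F"
      unfolding semi_filter_def by blast
    moreover have "(row N i \<inter> U, C i) \<in> \<Lambda>"
      using ij(2) unfolding \<Lambda>_def by blast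
    ultimately have "row N i \<inter> U \<inter> C i \<in> F"
      using F(2) row unfolding preserves_def by blast
    then show False
      using F(1) disjoint unfolding semi_filter_def by simp
  qed
  moreover have "\<Lambda> \<subseteq> Pow U \<times> Pow U"
    unfolding \<Lambda>_def C_def by blast
  ultimately have "covering_pairs (grid N) G (grid_generators N) \<Lambda>"
    unfolding covering_pairs_def U_def Let_def by blast
  moreover have "finite \<Lambda>"
    by (simp add: \<Lambda>_def)
  ultimately have "cover_complexity (grid N) G (grid_generators N) \<le> enat (card \<Lambda>)"
    unfolding cover_complexity_def by (intro Inf_lower) blast
  also have "card \<Lambda> \<le> N"
    using card_image_le[of "{1..N}"] unfolding \<Lambda>_def by fastforce
  finally show ?thesis by simp
qed

section \<open>Probability estimates\<close>

lemma prob_cover_complexity_le: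
  assumes N: "N \<ge> 6" and s: "10 * s \<le> N"
  shows "measure_pmf.prob (random_graph N)
    {G. cover_complexity (grid N) G (grid_generators N) \<le> enat s} \<le> (1 / 2) ^ N"
proof -
  define S where "S = {G. cover_complexity (grid N) G (grid_generators N) \<le> enat s}"
  \<comment> \<open>Scaling by 100 lets \<open>10 * s\<close> be replaced by \<open>N\<close>
    without division. The last estimate needs 310 N \<le> 58 N^2, which \<open>N \<ge> 6\<close>
    ensures. The extra summand \<open>N\<close> in the exponent becomes the bound
    \<open>(1 / 2) ^ N\<close>.\<close>
  have "100 * ((2 * N + s) * (2 * s + 1) + N) = (20 * N + 10 * s) * (2 * (10 * s) + 10) + 100 * N"
    by (simp add: algebra_simps)
  also have "\<dots> \<le> (20 * N + N) * (2 * N + 10) + 100 * N"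
    by (intro add_mono mult_mono) (use s in auto)
  also have "\<dots> = 42 * (N * N) + 310 * N"
    by (simp add: algebra_simps)
  also have "\<dots> \<le> 100 * (N * N)"
    using mult_le_mono1[OF N, of N] by linarith
  finally have exponent: "(2 * N + s) * (2 * s + 1) + N \<le> N * N"
    by simp
  have "Pow (grid N) \<inter> S =
      {A. A \<subseteq> grid N \<and> cover_complexity (grid N) A (grid_generators N) \<le> enat s}"
    by (auto simp: S_def)
  then have "card (Pow (grid N) \<inter> S) \<le> 2 ^ ((card (grid_generators N) + s) * (2 * s + 1))"
    using card_cover_complexity_le[OF finite_grid_generators grid_covered_by_generators] by simp
  also have "\<dots> \<le> 2 ^ ((2 * N + s) * (2 * s + 1))"
    using card_grid_generators_le by (intro power_increasing mult_right_mono add_right_mono) auto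
  finally have "card (Pow (grid N) \<inter> S) * 2 ^ N \<le> 2 ^ ((2 * N + s) * (2 * s + 1)) * 2 ^ N"
    by simp
  also have "\<dots> \<le> (2 :: nat) ^ (N * N)"
    unfolding power_add[symmetric] using exponent by (intro power_increasing) auto
  finally have "real (card (Pow (grid N) \<inter> S) * 2 ^ N) \<le> real (2 ^ (N * N))"
    by (rule of_nat_mono)
  then have "real (card (Pow (grid N) \<inter> S)) / 2 ^ (N * N) \<le> (1 / 2) ^ N"
    by (simp add: field_simps power_one_over)
  moreover have "finite (grid N)" "card (Pow (grid N)) = 2 ^ (N * N)"
    by (simp_all add: grid_def card_Pow card_cartesian_product)
  moreover have "measure_pmf.prob (random_graph N) S =
      real (card (Pow (grid N) \<inter> S)) / real (card (Pow (grid N)))"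
    unfolding random_graph_def by (rule measure_pmf_of_set) (use \<open>finite (grid N)\<close> in auto)
  ultimately show ?thesis
    by (simp add: S_def)
qed

lemma enat_le_div_if_not_ge:
  assumes "\<not> ereal (1 / 10 * real N) \<le> ereal_of_enat c"
  shows "c \<le> enat (N div 10)"
  using assms by (cases c) auto

theorem theorem1p2:
  "\<exists>c1 c2 :: real. 0 < c1 \<and> c1 \<le> c2 \<and>
     (\<lambda>n::nat. measure_pmf.prob (random_graph (2 ^ n))
        {G. ereal (c1 * 2 ^ n) \<le>
              ereal_of_enat (cover_complexity (grid (2 ^ n)) G (grid_generators (2 ^ n))) \<and>
            ereal_of_enat (cover_complexity (grid (2 ^ n)) G (grid_generators (2 ^ n)))
              \<le> ereal (c2 * 2 ^ n)})
     \<longlonglongrightarrow> 1"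
proof (intro exI conjI)
  let ?\<rho> = "\<lambda>n G. cover_complexity (grid (2 ^ n)) G (grid_generators (2 ^ n))"
  \<comment> \<open>The constants are 1/10 and 1; the factor \<open>1 *\<close> is kept so that the
    goal unifies with the second one.\<close>
  let ?good = "\<lambda>n. {G. ereal (1 / 10 * 2 ^ n) \<le> ereal_of_enat (?\<rho> n G) \<and>
    ereal_of_enat (?\<rho> n G) \<le> ereal (1 * 2 ^ n)}"
  show "(\<lambda>n. measure_pmf.prob (random_graph (2 ^ n)) (?good n)) \<longlonglongrightarrow> 1"
  proof (rule tendsto_sandwich)
    show "\<forall>\<^sub>F n in sequentially.
        1 - (1 / 2) ^ 2 ^ n \<le> measure_pmf.prob (random_graph (2 ^ n)) (?good n)"
      \<comment> \<open>3 is the least n with 2^n \<ge> 6.\<close>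
      using eventually_ge_at_top[of 3]
    proof eventually_elim
      case (elim n)
      let ?M = "random_graph (2 ^ n)"
      let ?bad = "{G. ?\<rho> n G \<le> enat (2 ^ n div 10)}"
      have "(2 :: nat) ^ 3 \<le> 2 ^ n"
        using elim by (intro power_increasing) auto
      then have "measure_pmf.prob ?M ?bad \<le> (1 / 2) ^ 2 ^ n"
        by (intro prob_cover_complexity_le) auto
      moreover have "1 - measure_pmf.prob ?M ?bad = measure_pmf.prob ?M (- ?bad)"
        using measure_pmf.prob_compl[of ?bad ?M] by (simp add: Compl_eq_Diff_UNIV)
      moreover have "measure_pmf.prob ?M (- ?bad) \<le> measure_pmf.prob ?M (?good n)"
      \<comment> \<open>The upper bound holds only for subsets of the grid, so the inclusion is used
        almost everywhere, on the support.\<close>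
      proof (rule measure_pmf.finite_measure_mono_AE)
        have "G \<in> ?good n" if "G \<subseteq> grid (2 ^ n)" "G \<notin> ?bad" for G
        proof -
          have "ereal (1 / 10 * 2 ^ n) \<le> ereal_of_enat (?\<rho> n G)"
            using that(2) enat_le_div_if_not_ge[of "2 ^ n" "?\<rho> n G"] by auto
          moreover have "ereal_of_enat (?\<rho> n G) \<le> ereal (1 * 2 ^ n)"
            using cover_complexity_grid_le[OF that(1)] by (cases "?\<rho> n G") auto
          ultimately show ?thesis by simp
        qed
        moreover have "set_pmf ?M = Pow (grid (2 ^ n))"
          unfolding random_graph_def by (rule set_pmf_of_set) (auto simp: grid_def)
        ultimately show "AE G in ?M. G \<in> - ?bad \<longrightarrow> G \<in> ?good n"
          by (intro AE_pmfI) blast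
      qed simp
      ultimately show ?case by linarith
    qed
    show "(\<lambda>n. 1 - (1 / 2) ^ 2 ^ n) \<longlonglongrightarrow> (1 :: real)"
      by real_asymp
    show "\<forall>\<^sub>F n in sequentially. measure_pmf.prob (random_graph (2 ^ n)) (?good n) \<le> 1"
      by simp
  qed simp
qed auto

end
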